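(* Let $K\in\mathbb{N}$ and suppose that under $M_K$ the parameters $\lambda_1,\ldots,\lambda_K$ are a priori independent and each $\lambda_i$ follows a gamma distribution with parameters $\breve a_i^{(K)}>0$ and $\breve b_i^{(K)}>0$, i.e. $\pi_{\underline{\lambda_i}}(\lambda_i|M_K)=f_G(\lambda_i|\breve a_i^{(K)},\breve b_i^{(K)})$. Assume that $\sum_{i=1}^{K}\breve a_i^{(K)}>K-1$. Then the coherent prior for $\lambda_1$ under $M_1$ is the gamma distribution with parameters $\breve a^{(1)}$ and $\breve b^{(1)}$, $\pi_{\underline{\lambda_1}}(\lambda_1|M_1)=f_G(\lambda_1|\breve a^{(1)},\breve b^{(1)})$, where $$\breve a^{(1)}=\sum_{i=1}^{K}\breve a_i^{(K)}-K+1,\qquad \breve b^{(1)}=\sum_{i=1}^{K}\breve b_i^{(K)}.$$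
   Context: For $a,b>0$ the gamma density is $f_G(x|a,b)=\frac{b^{a}}{\Gamma(a)}x^{a-1}\exp\{-bx\}$ for $x>0$ (and $0$ for $x\le 0$). $M_K$ is a $K$-component (mixture or Markov-switching) model containing a group of scalar mixture parameters $\lambda_1,\ldots,\lambda_K$, a priori independent of each other (and of all other parameters) with densities $\pi_{\underline{\lambda_i}}(\cdot|M_K)$. $M_1$ is the nested single-component model, with a single scalar parameter $\lambda_1$ in place of this group, obtained from $M_K$ under $\lambda_1=\ldots=\lambda_K$. All priors are assumed proper. Let $\tau_i=\lambda_i-\lambda_1$ ($i=2,\ldots,K$), $\tau=(\tau_2,\ldots,\tau_K)'$ (empty if $K=1$), and let $p(x,t)=p_\lambda(x,t_2+x,\ldots,t_K+x)$ be the joint prior density of $(\lambda_1,\tau)$ under $M_K$, with $p_\lambda$ the joint density of $(\lambda_1,\ldots,\lambda_K)$, evaluated pointwise. The coherent prior for $\lambda_1$ under $M_1$ is the conditional prior of $\lambda_1$ given $\tau=0$ under $M_K$, i.e. the distribution with density $x\mapsto p(x,0)/\int_{\mathbb{R}}p(u,0)\,du$. *)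

theory Defs
  imports "HOL-Probability.Probability"
begin

text \<open>Shape \<open>a\<close>, rate \<open>b\<close>; the value at \<open>x = 0\<close> is \<open>0\<close>.\<close>

definition gamma_density :: "real \<Rightarrow> real \<Rightarrow> real \<Rightarrow> real" where
  "gamma_density a b x =
     (if x > 0 then b powr a / Gamma a * x powr (a - 1) * exp (- b * x) else 0)"

text \<open>
  Vectors \<open>(\<lambda>\<^sub>1, \<dots>, \<lambda>\<^sub>K)\<close> and \<open>(\<tau>\<^sub>2, \<dots>, \<tau>\<^sub>K)\<close> are functions on \<open>nat\<close> that are only inspected on
  \<open>{1..K}\<close> and \<open>{2..K}\<close>.

  Conditioning on the null event \<open>\<tau> = 0\<close> depends on the version of the joint density. The version
  for independent components is the pointwise product of the given marginal densities.
\<close>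

definition independent_joint_density ::
    "nat \<Rightarrow> (nat \<Rightarrow> real \<Rightarrow> real) \<Rightarrow> (nat \<Rightarrow> real) \<Rightarrow> real" where
  "independent_joint_density K \<pi> v = (\<Prod>i=1..K. \<pi> i (v i))"

definition contrast_density ::
    "nat \<Rightarrow> ((nat \<Rightarrow> real) \<Rightarrow> real) \<Rightarrow> real \<Rightarrow> (nat \<Rightarrow> real) \<Rightarrow> real" where
  "contrast_density K p x t = p (\<lambda>i\<in>{1..K}. if i = 1 then x else t i + x)"

text \<open>
  If the normalising integral is zero or does not exist, this is the zero function (as \<open>y / 0 = 0\<close>)
  and hence not a probability density.
\<close>

definition coherent_prior_density ::
    "nat \<Rightarrow> ((nat \<Rightarrow> real) \<Rightarrow> real) \<Rightarrow> real \<Rightarrow> real" where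
  "coherent_prior_density K p x =
     contrast_density K p x (\<lambda>_. 0) / (\<integral>u. contrast_density K p u (\<lambda>_. 0) \<partial>lborel)"

lemma (in prob_space) independent_joint_density_distributed:
  assumes K: "1 \<le> K"
    and indep: "indep_vars (\<lambda>_. borel) X {1..K}"
    and dens: "\<And>i. i \<in> {1..K} \<Longrightarrow> distributed M lborel (X i) (\<lambda>x. ennreal (\<pi> i x))"
    and nonneg: "\<And>i x. i \<in> {1..K} \<Longrightarrow> 0 \<le> \<pi> i x"
  shows "distributed M (\<Pi>\<^sub>M i\<in>{1..K}. lborel) (\<lambda>\<omega>. \<lambda>i\<in>{1..K}. X i \<omega>)
           (\<lambda>v. ennreal (independent_joint_density K \<pi> v))"
proof -
  let ?I = "{1..K}"
  let ?L = "\<Pi>\<^sub>M i\<in>?I. (lborel :: real measure)"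
  let ?N = "\<lambda>i. density lborel (\<lambda>x. ennreal (if i \<in> ?I then \<pi> i x else indicator {0..1} x))"
  have Xm [measurable]: "X i \<in> borel_measurable M" if "i \<in> ?I" for i
    using distributed_measurable[OF dens[OF that]] by simp
  have pm [measurable]: "\<pi> i \<in> borel_measurable borel" if "i \<in> ?I" for i
    using distributed_real_measurable[OF _ dens[OF that]] nonneg[OF that] by simp
  have Nm: "(\<lambda>x. ennreal (if i \<in> ?I then \<pi> i x else indicator {0..1} x)) \<in> borel_measurable lborel" for i
    using pm[of i] by (cases "i \<in> ?I") auto
  interpret L: product_sigma_finite "\<lambda>_::nat. lborel :: real measure" ..
  have psN: "prob_space (?N i)" for i
  proof (cases "i \<in> ?I")
    case True
    then have "?N i = distr M lborel (X i)"
      using distributed_distr_eq_density[OF dens[OF True]] by simp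
    then show ?thesis using prob_space_distr[of "X i" lborel] Xm[OF True] by simp
  next
    case False
    then have "?N i = density lborel (indicator {0..1})"
      by (auto simp: ennreal_indicator intro!: density_cong)
    then show ?thesis by (intro prob_spaceI) (simp add: emeasure_density)
  qed
  interpret N: product_prob_space ?N UNIV
    by (intro product_prob_spaceI psN)
  let ?g = "\<lambda>v. ennreal (independent_joint_density K \<pi> v)"
  have gm: "?g \<in> borel_measurable ?L"
    unfolding independent_joint_density_def
    by (intro measurable_compose[OF _ measurable_ennreal] borel_measurable_prod
        measurable_compose[OF measurable_component_singleton]) (simp_all add: pm)
  have "distr M (\<Pi>\<^sub>M i\<in>?I. borel) (\<lambda>\<omega>. \<lambda>i\<in>?I. X i \<omega>) = (\<Pi>\<^sub>M i\<in>?I. distr M borel (X i))"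
    using indep_vars_iff_distr_eq_PiM'[of ?I X "\<lambda>_. borel"] indep K Xm by auto
  also have "(\<Pi>\<^sub>M i\<in>?I. distr M borel (X i)) = (\<Pi>\<^sub>M i\<in>?I. ?N i)"
  proof (rule PiM_cong[OF refl])
    fix i assume i: "i \<in> ?I"
    have "distr M borel (X i) = distr M lborel (X i)" by (rule distr_cong) simp_all
    then show "distr M borel (X i) = ?N i"
      using i distributed_distr_eq_density[OF dens[OF i]] by simp
  qed
  also have "\<dots> = density ?L ?g"
  proof (rule sym, rule N.PiM_eqI)
    show "sets (density ?L ?g) = sets (Pi\<^sub>M ?I ?N)"
      by (auto intro!: sets_PiM_cong)
    fix A assume A: "\<And>i. i \<in> ?I \<Longrightarrow> A i \<in> sets (?N i)"
    then have A': "\<And>i. i \<in> ?I \<Longrightarrow> A i \<in> sets borel" by simp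
    have PA: "Pi\<^sub>E ?I A \<in> sets ?L" using A' by (intro sets_PiM_I_finite) auto
    have "emeasure (density ?L ?g) (Pi\<^sub>E ?I A) = (\<integral>\<^sup>+ v. ?g v * indicator (Pi\<^sub>E ?I A) v \<partial>?L)"
      by (rule emeasure_density[OF gm PA])
    also have "\<dots> = (\<integral>\<^sup>+ v. (\<Prod>i\<in>?I. ennreal (\<pi> i (v i)) * indicator (A i) (v i)) \<partial>?L)"
    proof (rule nn_integral_cong)
      fix v assume "v \<in> space ?L"
      then have "indicator (Pi\<^sub>E ?I A) v = (\<Prod>i\<in>?I. indicator (A i) (v i) :: ennreal)"
        by (auto simp: indicator_def space_PiM PiE_iff prod_zero_iff)
      moreover have "?g v = (\<Prod>i\<in>?I. ennreal (\<pi> i (v i)))"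
        unfolding independent_joint_density_def by (rule prod_ennreal[symmetric]) (rule nonneg)
      ultimately show "?g v * indicator (Pi\<^sub>E ?I A) v
          = (\<Prod>i\<in>?I. ennreal (\<pi> i (v i)) * indicator (A i) (v i))"
        by (simp add: prod.distrib)
    qed
    also have "\<dots> = (\<Prod>i\<in>?I. \<integral>\<^sup>+ x. ennreal (\<pi> i x) * indicator (A i) x \<partial>lborel)"
      using A' by (intro L.product_nn_integral_prod) (auto intro!: borel_measurable_times_ennreal
          measurable_compose[OF _ measurable_ennreal] pm)
    also have "\<dots> = (\<Prod>i\<in>?I. emeasure (?N i) (A i))"
    proof (rule prod.cong[OF refl])
      fix i assume i: "i \<in> ?I"
      show "(\<integral>\<^sup>+ x. ennreal (\<pi> i x) * indicator (A i) x \<partial>lborel) = emeasure (?N i) (A i)"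
        using i A'[OF i] by (subst emeasure_density[OF Nm]) simp_all
    qed
    finally show "emeasure (density ?L ?g) (Pi\<^sub>E ?I A) = (\<Prod>i\<in>?I. emeasure (?N i) (A i))" .
  qed simp
  finally have eq: "distr M (\<Pi>\<^sub>M i\<in>?I. borel) (\<lambda>\<omega>. \<lambda>i\<in>?I. X i \<omega>) = density ?L ?g" .
  have "distr M ?L (\<lambda>\<omega>. \<lambda>i\<in>?I. X i \<omega>) = distr M (\<Pi>\<^sub>M i\<in>?I. borel) (\<lambda>\<omega>. \<lambda>i\<in>?I. X i \<omega>)"
    by (rule distr_cong) (auto intro!: sets_PiM_cong)
  with eq gm show ?thesis
    unfolding distributed_def by (auto intro!: measurable_restrict Xm)
qed

lemma nn_integral_PiM_lborel_translate:
  fixes x :: real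
  assumes I: "finite I" and f: "f \<in> borel_measurable (\<Pi>\<^sub>M i\<in>I. (lborel :: real measure))"
  shows "(\<integral>\<^sup>+ t. f (\<lambda>i\<in>I. t i + x) \<partial>(\<Pi>\<^sub>M i\<in>I. lborel)) = (\<integral>\<^sup>+ t. f t \<partial>(\<Pi>\<^sub>M i\<in>I. lborel))"
proof -
  let ?L = "\<Pi>\<^sub>M i\<in>I. (lborel :: real measure)"
  interpret L: product_sigma_finite "\<lambda>_. lborel :: real measure" ..
  have T: "(\<lambda>t. \<lambda>i\<in>I. t i + x) \<in> measurable ?L ?L" by measurable
  have "distr ?L ?L (\<lambda>t. \<lambda>i\<in>I. t i + x) = ?L"
  proof (rule L.PiM_eqI[OF I])
    fix A assume A: "\<And>i. i \<in> I \<Longrightarrow> A i \<in> sets (lborel :: real measure)"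
    have A': "(\<lambda>y. y + x) -` A i \<in> sets lborel" if "i \<in> I" for i
      using measurable_sets[of "\<lambda>y. y + x" borel borel "A i"] A[OF that] by simp
    have "emeasure (distr ?L ?L (\<lambda>t. \<lambda>i\<in>I. t i + x)) (Pi\<^sub>E I A)
        = emeasure ?L ((\<lambda>t. \<lambda>i\<in>I. t i + x) -` Pi\<^sub>E I A \<inter> space ?L)"
      using A I by (intro emeasure_distr[OF T] sets_PiM_I_finite) auto
    also have "(\<lambda>t. \<lambda>i\<in>I. t i + x) -` Pi\<^sub>E I A \<inter> space ?L = (\<Pi>\<^sub>E i\<in>I. (\<lambda>y. y + x) -` A i)"
      by (auto simp: space_PiM PiE_iff)
    also have "emeasure ?L \<dots> = (\<Prod>i\<in>I. emeasure lborel ((\<lambda>y. y + x) -` A i))"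
      by (rule L.emeasure_PiM[OF I A'])
    also have "\<dots> = (\<Prod>i\<in>I. emeasure lborel (A i))"
    proof (rule prod.cong[OF refl])
      fix i assume i: "i \<in> I"
      have shift: "(+) x = (\<lambda>y. y + x)" by (simp add: fun_eq_iff)
      have "emeasure lborel (A i) = emeasure (distr lborel borel ((+) x)) (A i)"
        using lborel_distr_plus[of x] by simp
      also have "\<dots> = emeasure lborel ((\<lambda>y. y + x) -` A i)"
        using A[OF i] by (subst emeasure_distr) (simp_all add: shift)
      finally show "emeasure lborel ((\<lambda>y. y + x) -` A i) = emeasure lborel (A i)" ..
    qed
    finally show "emeasure (distr ?L ?L (\<lambda>t. \<lambda>i\<in>I. t i + x)) (Pi\<^sub>E I A)
        = (\<Prod>i\<in>I. emeasure lborel (A i))" .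
  qed simp
  then have "(\<integral>\<^sup>+ t. f t \<partial>?L) = (\<integral>\<^sup>+ t. f t \<partial>distr ?L ?L (\<lambda>t. \<lambda>i\<in>I. t i + x))" by simp
  also have "\<dots> = (\<integral>\<^sup>+ t. f (\<lambda>i\<in>I. t i + x) \<partial>?L)"
    using f by (intro nn_integral_distr[OF T]) simp
  finally show ?thesis ..
qed

lemma contrast_density_distributed:
  assumes K: "1 \<le> K"
    and D: "distributed M (\<Pi>\<^sub>M i\<in>{1..K}. lborel) (\<lambda>\<omega>. \<lambda>i\<in>{1..K}. X i \<omega>) (\<lambda>v. ennreal (p v))"
  shows "distributed M (lborel \<Otimes>\<^sub>M (\<Pi>\<^sub>M i\<in>{2..K}. lborel))
           (\<lambda>\<omega>. (X 1 \<omega>, \<lambda>i\<in>{2..K}. X i \<omega> - X 1 \<omega>))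
           (\<lambda>(x, t). ennreal (contrast_density K p x t))"
proof -
  let ?I = "{1..K}" and ?J = "{2..K}"
  let ?L = "\<Pi>\<^sub>M i\<in>?I. (lborel :: real measure)" and ?LJ = "\<Pi>\<^sub>M i\<in>?J. (lborel :: real measure)"
  let ?N = "(lborel :: real measure) \<Otimes>\<^sub>M ?LJ"
  let ?V = "\<lambda>\<omega>. \<lambda>i\<in>?I. X i \<omega>"
  let ?T = "\<lambda>v :: nat \<Rightarrow> real. (v 1, \<lambda>i\<in>?J. v i - v 1)"
  let ?S = "\<lambda>(x :: real, t :: nat \<Rightarrow> real). \<lambda>i\<in>?I. if i = 1 then x else t i + x"
  have I: "?I = insert 1 ?J" using K by auto
  interpret L: product_sigma_finite "\<lambda>_. lborel :: real measure" ..
  interpret LJ: sigma_finite_measure ?LJ by (rule L.sigma_finite) simp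
  have pm: "(\<lambda>v. ennreal (p v)) \<in> borel_measurable ?L"
    using D by (rule distributed_borel_measurable)
  have Vm: "?V \<in> measurable M ?L" using D by (rule distributed_measurable)
  have T: "?T \<in> measurable ?L ?N"
    using K by (intro measurable_Pair measurable_restrict borel_measurable_diff
        measurable_component_singleton) 
      (auto intro!: borel_measurable_diff measurable_component_singleton)
  have S: "?S \<in> measurable ?N ?L"
    unfolding case_prod_beta
  proof (rule measurable_restrict)
    fix i assume i: "i \<in> ?I"
    show "(\<lambda>z. if i = 1 then fst z else snd z i + fst z) \<in> measurable ?N lborel"
    proof (cases "i = 1")
      case False
      with i have "i \<in> ?J" by auto
      then have "(\<lambda>z. snd z i) \<in> borel_measurable ?N"
        using measurable_compose[OF measurable_snd measurable_component_singleton] by fastforce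
      then show ?thesis using False by simp
    qed simp
  qed
  have cm: "(\<lambda>(x, t). ennreal (contrast_density K p x t)) \<in> borel_measurable ?N"
    using measurable_compose[OF S pm] by (simp add: contrast_density_def case_prod_unfold)
  have TV: "(\<lambda>\<omega>. (X 1 \<omega>, \<lambda>i\<in>?J. X i \<omega> - X 1 \<omega>)) = (\<lambda>\<omega>. ?T (?V \<omega>))"
    using K by (auto simp: fun_eq_iff)
  have TVm: "(\<lambda>\<omega>. ?T (?V \<omega>)) \<in> measurable M ?N"
    using measurable_compose[OF Vm T] .
  have "distr M ?N (\<lambda>\<omega>. ?T (?V \<omega>)) = density ?N (\<lambda>(x, t). ennreal (contrast_density K p x t))"
  proof (rule measure_eqI)
    fix A assume "A \<in> sets (distr M ?N (\<lambda>\<omega>. ?T (?V \<omega>)))"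
    then have A: "A \<in> sets ?N" by simp
    let ?h = "\<lambda>v. ennreal (p v) * indicator A (?T v)"
    have Am: "(\<lambda>v. indicator A (?T v) :: ennreal) \<in> borel_measurable ?L"
      using measurable_compose[OF T borel_measurable_indicator[OF A]] .
    have hm: "?h \<in> borel_measurable ?L"
      using pm Am by simp
    have hm': "?h \<in> borel_measurable (\<Pi>\<^sub>M i\<in>insert 1 ?J. lborel)"
      using hm I by simp
    have "emeasure (distr M ?N (\<lambda>\<omega>. ?T (?V \<omega>))) A = (\<integral>\<^sup>+ z. indicator A z \<partial>distr M ?N (\<lambda>\<omega>. ?T (?V \<omega>)))"
      using A by simp
    also have "\<dots> = (\<integral>\<^sup>+ \<omega>. indicator A (?T (?V \<omega>)) \<partial>M)"
      using A by (intro nn_integral_distr[OF TVm]) simp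
    also have "\<dots> = (\<integral>\<^sup>+ v. ?h v \<partial>?L)"
      using distributed_nn_integral[OF D Am] by simp
    also have "\<dots> = (\<integral>\<^sup>+ x. \<integral>\<^sup>+ w. ?h (w(1 := x)) \<partial>?LJ \<partial>lborel)"
      unfolding I by (rule L.product_nn_integral_insert_rev[OF _ _ hm']) auto
    also have "\<dots> = (\<integral>\<^sup>+ x. \<integral>\<^sup>+ t. ennreal (contrast_density K p x t) * indicator A (x, t) \<partial>?LJ \<partial>lborel)"
    proof (rule nn_integral_cong)
      fix x :: real
      have um: "(\<lambda>w. w(1 := x)) \<in> measurable ?LJ ?L"
        unfolding I by (rule measurable_fun_upd[where J = ?J]) auto
      have hx: "(\<lambda>w. ?h (w(1 := x))) \<in> borel_measurable ?LJ"
        by (rule measurable_compose[OF um hm])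
      have "(\<integral>\<^sup>+ w. ?h (w(1 := x)) \<partial>?LJ) = (\<integral>\<^sup>+ t. ?h ((\<lambda>i\<in>?J. t i + x)(1 := x)) \<partial>?LJ)"
        by (rule nn_integral_PiM_lborel_translate[OF _ hx, symmetric]) simp
      also have "\<dots> = (\<integral>\<^sup>+ t. ennreal (contrast_density K p x t) * indicator A (x, t) \<partial>?LJ)"
      proof (rule nn_integral_cong)
        fix t assume "t \<in> space ?LJ"
        then have t: "t \<in> extensional ?J" by (simp add: space_PiM PiE_def)
        have "(\<lambda>i\<in>?J. t i + x)(1 := x) = (\<lambda>i\<in>?I. if i = 1 then x else t i + x)"
          using K by (auto simp: fun_eq_iff)
        moreover have "?T ((\<lambda>i\<in>?J. t i + x)(1 := x)) = (x, t)"
          using t by (auto simp: fun_eq_iff extensional_def)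
        ultimately show "?h ((\<lambda>i\<in>?J. t i + x)(1 := x))
            = ennreal (contrast_density K p x t) * indicator A (x, t)"
          by (metis contrast_density_def)
      qed
      finally show "(\<integral>\<^sup>+ w. ?h (w(1 := x)) \<partial>?LJ)
          = (\<integral>\<^sup>+ t. ennreal (contrast_density K p x t) * indicator A (x, t) \<partial>?LJ)" .
    qed
    also have "\<dots> = (\<integral>\<^sup>+ z. (\<lambda>(x, t). ennreal (contrast_density K p x t)) z * indicator A z \<partial>?N)"
      using LJ.nn_integral_fst[of "\<lambda>z. (\<lambda>(x, t). ennreal (contrast_density K p x t)) z * indicator A z" lborel]
        cm A by simp
    also have "\<dots> = emeasure (density ?N (\<lambda>(x, t). ennreal (contrast_density K p x t))) A"
      by (rule emeasure_density[OF cm A, symmetric])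
    finally show "emeasure (distr M ?N (\<lambda>\<omega>. ?T (?V \<omega>))) A
        = emeasure (density ?N (\<lambda>(x, t). ennreal (contrast_density K p x t))) A" .
  qed simp
  then show ?thesis
    unfolding distributed_def TV using cm TVm by simp
qed

end

theory Submission
  imports Defs
begin

text \<open>
  At \<open>\<tau> = 0\<close> all coordinates coincide, so the joint density of \<open>(\<lambda>\<^sub>1, \<tau>)\<close> is there the pointwise
  product of the \<open>K\<close> gamma densities. On \<open>x > 0\<close> this product has the gamma form: the rates add up,
  and so do the exponents, the \<open>i\<close>-th of which is the shape \<open>a\<^sub>i\<close> minus one; hence the combined shape
  \<open>A\<close> satisfies \<open>A - 1 = (\<Sum>\<^sub>i a\<^sub>i) - K\<close>, which is where \<open>- K + 1\<close> comes from
  (\<open>gamma_kernel_prod\<close>). The product is therefore a nonzero multiple of a gamma density, and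
  since \<open>A > 0\<close> is precisely what makes that density integrable near zero, its
  integral is one (\<open>integral_gamma_density\<close>) and normalisation removes the multiple.
\<close>

lemma gamma_density_rescale:
  assumes "b > 0"
  shows "gamma_density a b (x / b) = b * gamma_density a 1 x"
  using assms by (simp add: gamma_density_def zero_less_divide_iff powr_divide powr_diff)

lemma integral_gamma_density_rate_1:
  assumes a: "a > 0"
  shows "(\<integral>x. gamma_density a 1 x \<partial>lborel) = 1"
proof -
  have G: "Gamma a > 0" using a by (rule Gamma_real_pos)
  let ?g = "\<lambda>t. indicator {0..} t * t powr (a - 1) / exp t"
  have "gamma_density a 1 = (\<lambda>t. ?g t / Gamma a)"
    by (simp add: fun_eq_iff gamma_density_def indicator_def exp_minus field_simps)
  then have "(\<integral>t. gamma_density a 1 t \<partial>lborel) = (\<integral>t. ?g t \<partial>lborel) / Gamma a"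
    by (simp only: integral_divide_zero)
  moreover have "(\<integral>t. ?g t \<partial>lborel) = Gamma a"
    using G Gamma_conv_nn_integral_real[OF a]
    by (intro integral_eq_nn_integral[THEN trans]) (auto simp flip: Gamma_conv_nn_integral_real)
  ultimately show ?thesis using G by simp
qed

text \<open>The rate is a scale parameter, so the substitution \<open>x \<mapsto> x / b\<close> reduces the claim to rate one,
  which is Euler's integral for \<open>Gamma a\<close>.\<close>

lemma integral_gamma_density:
  assumes "a > 0" "b > 0"
  shows "(\<integral>x. gamma_density a b x \<partial>lborel) = 1"
proof -
  have "(\<integral>x. gamma_density a b x \<partial>lborel) = \<bar>1 / b\<bar> * (\<integral>x. gamma_density a b (0 + 1 / b * x) \<partial>lborel)"
    using lborel_integral_real_affine[of "1 / b" "gamma_density a b" 0] assms by simp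
  also have "\<dots> = \<bar>1 / b\<bar> * (\<integral>x. b * gamma_density a 1 x \<partial>lborel)"
    using assms by (simp add: gamma_density_rescale)
  also have "\<dots> = 1"
    using assms by (simp add: integral_gamma_density_rate_1)
  finally show ?thesis .
qed

lemma gamma_kernel_prod:
  fixes x :: real
  assumes "finite I" "x > 0"
  shows "(\<Prod>i\<in>I. x powr (a i - 1) * exp (- b i * x)) =
         x powr ((\<Sum>i\<in>I. a i) - card I) * exp (- (\<Sum>i\<in>I. b i) * x)"
proof -
  have "(\<Prod>i\<in>I. x powr (a i - 1)) = x powr (\<Sum>i\<in>I. a i - 1)"
    using assms by (simp add: powr_sum)
  moreover have "(\<Prod>i\<in>I. exp (- b i * x)) = exp (\<Sum>i\<in>I. - b i * x)"
    using assms by (simp add: exp_sum)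
  ultimately show ?thesis
    by (simp add: prod.distrib sum_subtractf sum_negf sum_distrib_right)
qed

text \<open>The constant is the product of the individual normalising constants divided by that of the
  combined density; any nonzero value cancels on normalisation. The index set must be nonempty
  because the empty product is one on the negative half-line too, where a gamma density vanishes.\<close>

lemma gamma_density_prod_proportional:
  assumes I: "finite I" "I \<noteq> {}"
    and pos: "\<And>i. i \<in> I \<Longrightarrow> a i > 0" "\<And>i. i \<in> I \<Longrightarrow> b i > 0"
    and A: "(\<Sum>i\<in>I. a i) - real (card I) + 1 > 0"
  obtains C where "C \<noteq> 0"
    and "\<And>x. (\<Prod>i\<in>I. gamma_density (a i) (b i) x) =
      C * gamma_density ((\<Sum>i\<in>I. a i) - real (card I) + 1) (\<Sum>i\<in>I. b i) x"
proof -
  let ?A = "(\<Sum>i\<in>I. a i) - real (card I) + 1" and ?B = "\<Sum>i\<in>I. b i"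
  define c where "c = (\<Prod>i\<in>I. b i powr a i / Gamma (a i))"
  define d where "d = ?B powr ?A / Gamma ?A"
  have B: "?B > 0" using I pos by (simp add: sum_pos)
  have "d > 0" unfolding d_def using A B by (simp add: Gamma_real_pos)
  have "c > 0" unfolding c_def
    using pos by (intro prod_pos divide_pos_pos Gamma_real_pos) (auto simp: less_imp_neq[symmetric])
  show thesis
  proof
    show "c / d \<noteq> 0" using \<open>c > 0\<close> \<open>d > 0\<close> by simp
    fix x
    show "(\<Prod>i\<in>I. gamma_density (a i) (b i) x) = c / d * gamma_density ?A ?B x"
    proof (cases "x > 0")
      case True
      have "(\<Prod>i\<in>I. gamma_density (a i) (b i) x) =
          c * (\<Prod>i\<in>I. x powr (a i - 1) * exp (- b i * x))"
        using True by (simp add: gamma_density_def c_def mult.assoc flip: prod.distrib)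
      also have "\<dots> = c * (x powr (?A - 1) * exp (- ?B * x))"
        using gamma_kernel_prod[OF I(1) True, of a b] by simp
      also have "\<dots> = c / d * (d * x powr (?A - 1) * exp (- ?B * x))"
        using \<open>d > 0\<close> by simp
      also have "d * x powr (?A - 1) * exp (- ?B * x) = gamma_density ?A ?B x"
        using True by (simp add: gamma_density_def d_def)
      finally show ?thesis .
    next
      case False
      then show ?thesis using I by (auto simp: gamma_density_def card_gt_0_iff)
    qed
  qed
qed

lemma contrast_density_at_zero:
  "contrast_density K (independent_joint_density K \<pi>) x (\<lambda>_. 0) = (\<Prod>i=1..K. \<pi> i x)"
  unfolding contrast_density_def independent_joint_density_def by (intro prod.cong) auto

theorem proposition3:
  fixes K :: nat
    and M :: "'a measure"
    and lam :: "nat \<Rightarrow> 'a \<Rightarrow> real"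
    and a b :: "nat \<Rightarrow> real"
  assumes "1 \<le> K"
    and "prob_space M"
    and "prob_space.indep_vars M (\<lambda>_. borel) lam {1..K}"
    and "\<And>i. i \<in> {1..K} \<Longrightarrow> a i > 0"
    and "\<And>i. i \<in> {1..K} \<Longrightarrow> b i > 0"
    and "\<And>i. i \<in> {1..K} \<Longrightarrow>
           distributed M lborel (lam i) (\<lambda>x. ennreal (gamma_density (a i) (b i) x))"
    and "(\<Sum>i=1..K. a i) > real K - 1"
  shows "(\<Sum>i=1..K. a i) - real K + 1 > 0 \<and> (\<Sum>i=1..K. b i) > 0 \<and>
         coherent_prior_density K (independent_joint_density K (\<lambda>i. gamma_density (a i) (b i))) =
           gamma_density ((\<Sum>i=1..K. a i) - real K + 1) (\<Sum>i=1..K. b i)"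
proof -
  let ?A = "(\<Sum>i=1..K. a i) - real K + 1" and ?B = "\<Sum>i=1..K. b i"
  have A: "?A > 0" using assms(7) by simp
  have B: "?B > 0" using assms(1,5) by (intro sum_pos) auto
  obtain C where C: "C \<noteq> 0"
    and prod: "\<And>x. (\<Prod>i=1..K. gamma_density (a i) (b i) x) = C * gamma_density ?A ?B x"
    using gamma_density_prod_proportional[of "{1..K}" a b] assms(1,4,5) A by auto
  have "coherent_prior_density K (independent_joint_density K (\<lambda>i. gamma_density (a i) (b i))) =
      gamma_density ?A ?B"
    using C integral_gamma_density[OF A B]
    by (simp add: fun_eq_iff coherent_prior_density_def contrast_density_at_zero prod del: One_nat_def)
  with A B show ?thesis by blast
qed

end
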